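(* The Cartan canonical connection $C\Gamma_{[3]}$ of the rheonomic Chernov metric $$F_{[3]}(t,y)=\sqrt{h^{11}(t)}\cdot\sqrt[3]{y_1^1y_1^2y_1^3+y_1^1y_1^2y_1^4+y_1^1y_1^3y_1^4+y_1^2y_1^3y_1^4}$$ has three effective local torsion d-tensors: $$P_{(1)i(j)}^{(k)\ (1)}=-\frac12\varkappa_{11}^1C_{i(j)}^{k(1)},\qquad P_{i(j)}^{k(1)}=C_{i(j)}^{k(1)},\qquad R_{(1)1j}^{(k)}=\frac12\left(\frac{d\varkappa_{11}^1}{dt}-\varkappa_{11}^1\varkappa_{11}^1\right)\delta_j^k .$$ That is, with $T$ the torsion of the connection, $$T\left(\frac{\partial}{\partial y_1^j},\frac{\delta}{\delta x^i}\right)=P_{i(j)}^{k(1)}\frac{\delta}{\delta x^k}+P_{(1)i(j)}^{(k)\ (1)}\frac{\partial}{\partial y_1^k},\qquad T\left(\frac{\delta}{\delta x^j},\frac{\delta}{\delta t}\right)=R_{(1)1j}^{(k)}\frac{\partial}{\partial y_1^k}$$ with the coefficients $P_{i(j)}^{k(1)}=C_{i(j)}^{k(1)}$, $P_{(1)i(j)}^{(k)\ (1)}=-\frac12\varkappa_{11}^1C_{i(j)}^{k(1)}$ and $R_{(1)1j}^{(k)}=\frac12\left(\frac{d\varkappa_{11}^1}{dt}-\varkappa_{11}^1\varkappa_{11}^1\right)\delta_j^k$, and all other adapted components of $T$ (up to antisymmetry) vanish.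
   Context: $M^4$ is a smooth $4$-dimensional manifold with local coordinates $(x^1,\dots,x^4)$; $J^1(\mathbb{R},M^4)$ has local coordinates $(t,x^1,\dots,x^4,y_1^1,\dots,y_1^4)$. $h_{11}(t)>0$ is a Riemannian metric on $\mathbb{R}$, $h^{11}=1/h_{11}$, and $\varkappa_{11}^1=\frac{h^{11}}{2}\frac{dh_{11}}{dt}$. Latin indices run from $1$ to $4$, repeated indices are summed; cube roots are real. Everything is considered on the open set where $S_{[3]111}=y_1^1y_1^2y_1^3+y_1^1y_1^2y_1^4+y_1^1y_1^3y_1^4+y_1^2y_1^3y_1^4\neq0$ and the Hessian $(\partial^2S_{[3]111}/\partial y_1^i\partial y_1^j)$ is invertible. The fundamental metrical d-tensor is $g_{[3]ij}=\frac{h_{11}}{2}\frac{\partial^2F_{[3]}^2}{\partial y_1^i\partial y_1^j}$, with inverse $(g_{[3]}^{jk})$. The canonical nonlinear connection of $F_{[3]}$ is $\Gamma_{[3]}=(M_{(1)1}^{(i)}=-\varkappa_{11}^1y_1^i,\ N_{(1)j}^{(i)}=-\frac{\varkappa_{11}^1}{2}\delta_j^i)$, giving the adapted basis of vector fields $$\frac{\delta}{\delta t}=\frac{\partial}{\partial t}+\varkappa_{11}^1y_1^p\frac{\partial}{\partial y_1^p},\qquad \frac{\delta}{\delta x^i}=\frac{\partial}{\partial x^i}+\frac{\varkappa_{11}^1}{2}\frac{\partial}{\partial y_1^i},\qquad\frac{\partial}{\partial y_1^i}.$$ The Cartan canonical connection $C\Gamma_{[3]}=(\varkappa_{11}^1,G_{j1}^k,L_{jk}^i,C_{j(k)}^{i(1)})$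 has $$G_{j1}^k=\frac{g_{[3]}^{km}}{2}\frac{\delta g_{[3]mj}}{\delta t},\qquad L_{jk}^i=\frac{g_{[3]}^{im}}{2}\left(\frac{\delta g_{[3]jm}}{\delta x^k}+\frac{\delta g_{[3]km}}{\delta x^j}-\frac{\delta g_{[3]jk}}{\delta x^m}\right),$$ $$C_{j(k)}^{i(1)}=\frac{g_{[3]}^{im}}{2}\left(\frac{\partial g_{[3]jm}}{\partial y_1^k}+\frac{\partial g_{[3]km}}{\partial y_1^j}-\frac{\partial g_{[3]jk}}{\partial y_1^m}\right),$$ and is the ($h$-normal) linear connection $\nabla$ on $J^1(\mathbb{R},M^4)$ given by $$\nabla_{\frac{\delta}{\delta t}}\tfrac{\delta}{\delta t}=\varkappa_{11}^1\tfrac{\delta}{\delta t},\quad \nabla_{\frac{\delta}{\delta t}}\tfrac{\delta}{\delta x^i}=G_{i1}^k\tfrac{\delta}{\delta x^k},\quad \nabla_{\frac{\delta}{\delta t}}\tfrac{\partial}{\partial y_1^i}=(G_{i1}^k-\delta_i^k\varkappa_{11}^1)\tfrac{\partial}{\partial y_1^k},$$ $$\nabla_{\frac{\delta}{\delta x^j}}\tfrac{\delta}{\delta t}=0,\quad \nabla_{\frac{\delta}{\delta x^j}}\tfrac{\delta}{\delta x^i}=L_{ij}^k\tfrac{\delta}{\delta x^k},\quad \nabla_{\frac{\delta}{\delta x^j}}\tfrac{\partial}{\partial y_1^i}=L_{ij}^k\tfrac{\partial}{\partial y_1^k},$$ $$\nabla_{\frac{\partial}{\partial y_1^j}}\tfrac{\delta}{\delta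 t}=0,\quad \nabla_{\frac{\partial}{\partial y_1^j}}\tfrac{\delta}{\delta x^i}=C_{i(j)}^{k(1)}\tfrac{\delta}{\delta x^k},\quad \nabla_{\frac{\partial}{\partial y_1^j}}\tfrac{\partial}{\partial y_1^i}=C_{i(j)}^{k(1)}\tfrac{\partial}{\partial y_1^k}.$$ Its torsion is $T(X,Y)=\nabla_XY-\nabla_YX-[X,Y]$. "Effective" torsion d-tensors are the adapted components of $T$ that do not vanish identically in general. *)

theory Defs
  imports "HOL-Analysis.Analysis"
begin

text \<open>
  Everything is written in a chart: if \<open>U\<close> is the image in \<open>real^4\<close> of a coordinate chart of the
  manifold, the induced chart of the 1-jet space is \<open>UNIV \<times> U \<times> UNIV\<close>, with points \<open>(t, x, y)\<close>.
  A vector field is a map from points to tangent vectors, the latter being given by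
  their components in the natural basis \<open>\<partial>/\<partial>t, \<partial>/\<partial>x^i, \<partial>/\<partial>y^i\<close>.
\<close>

type_synonym jet = "real \<times> (real^4) \<times> (real^4)"
type_synonym vfield = "jet \<Rightarrow> jet"

definition dir_deriv :: "vfield \<Rightarrow> (jet \<Rightarrow> 'a::real_normed_vector) \<Rightarrow> jet \<Rightarrow> 'a" where
  "dir_deriv X f p = frechet_derivative f (at p) (X p)"

definition lie_bracket :: "vfield \<Rightarrow> vfield \<Rightarrow> vfield" where
  "lie_bracket X Y p = dir_deriv X Y p - dir_deriv Y X p"

definition riemannian_metric_R :: "(real \<Rightarrow> real) \<Rightarrow> bool" where
  "riemannian_metric_R h \<longleftrightarrow>
     (\<forall>n t. ((deriv ^^ n) h) differentiable (at t)) \<and> (\<forall>t. h t > 0)"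

definition varkappa :: "(real \<Rightarrow> real) \<Rightarrow> real \<Rightarrow> real" where
  "varkappa h t = (1 / h t) / 2 * deriv h t"


subsection \<open>The adapted frame\<close>

datatype adapted = Tm | Hor 4 | Ver 4

lemma UNIV_adapted: "UNIV = insert Tm (range Hor \<union> range Ver)"
  by (auto intro: adapted.exhaust)

instance adapted :: finite
  by standard (simp add: UNIV_adapted)

lemma sum_adapted:
  fixes f :: "adapted \<Rightarrow> 'a::ab_group_add"
  shows "(\<Sum>A\<in>UNIV. f A) = f Tm + ((\<Sum>i\<in>UNIV. f (Hor i)) + (\<Sum>i\<in>UNIV. f (Ver i)))"
proof -
  have "(\<Sum>A\<in>UNIV. f A) = f Tm + sum f (range Hor \<union> range Ver)"
    unfolding UNIV_adapted by (subst sum.insert) auto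
  also have "sum f (range Hor \<union> range Ver) = sum f (range Hor) + sum f (range Ver)"
    by (rule sum.union_disjoint) auto
  also have "\<dots> = (\<Sum>i\<in>UNIV. f (Hor i)) + (\<Sum>i\<in>UNIV. f (Ver i))"
    by (simp add: sum.reindex inj_on_def)
  finally show ?thesis .
qed

text \<open>\<open>Tm\<close>, \<open>Hor i\<close>, \<open>Ver i\<close> index \<open>\<delta>/\<delta>t\<close>, \<open>\<delta>/\<delta>x^i\<close>, \<open>\<partial>/\<partial>y^i\<close>.\<close>

fun frame :: "(real \<Rightarrow> real) \<Rightarrow> adapted \<Rightarrow> vfield" where
  "frame h Tm (t, x, y) = (1, 0, varkappa h t *\<^sub>R y)"
| "frame h (Hor i) (t, x, y) = (0, axis i 1, (varkappa h t / 2) *\<^sub>R axis i 1)"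
| "frame h (Ver i) (t, x, y) = (0, 0, axis i 1)"

text \<open>\<open>coframe h A p v\<close> is the component of the tangent vector \<open>v\<close> at \<open>p\<close> along \<open>frame h A\<close>.\<close>

fun coframe :: "(real \<Rightarrow> real) \<Rightarrow> adapted \<Rightarrow> jet \<Rightarrow> jet \<Rightarrow> real" where
  "coframe h Tm (t, x, y) (a, b, c) = a"
| "coframe h (Hor i) (t, x, y) (a, b, c) = b $ i"
| "coframe h (Ver i) (t, x, y) (a, b, c) = c $ i - varkappa h t * a * y $ i - varkappa h t / 2 * b $ i"

lemma coframe_frame: "coframe h A p (frame h B p) = (if A = B then 1 else 0)"
  by (cases p; cases A; cases B) (auto simp: axis_def)

lemma frame_expansion: "(\<Sum>A\<in>UNIV. coframe h A p v *\<^sub>R frame h A p) = v"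
proof -
  obtain t x y a b c where [simp]: "p = (t, x, y)" "v = (a, b, c)"
    by (cases p; cases v) auto
  show ?thesis
    unfolding sum_adapted
    by (auto simp: prod_eq_iff fst_sum snd_sum vec_eq_iff axis_def if_distrib
        algebra_simps cong: if_cong)
qed


subsection \<open>The rheonomic Chernov metric\<close>

fun chernov_S :: "jet \<Rightarrow> real" where
  "chernov_S (t, x, y) =
     y$1 * y$2 * y$3 + y$1 * y$2 * y$4 + y$1 * y$3 * y$4 + y$2 * y$3 * y$4"

definition chernov_F :: "(real \<Rightarrow> real) \<Rightarrow> jet \<Rightarrow> real" where
  "chernov_F h p = sqrt (1 / h (fst p)) * root 3 (chernov_S p)"

definition d_y :: "4 \<Rightarrow> (jet \<Rightarrow> real) \<Rightarrow> jet \<Rightarrow> real" where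
  "d_y i = dir_deriv (\<lambda>p. (0, 0, axis i 1))"

definition chernov_domain :: "(real^4) set \<Rightarrow> jet set" where
  "chernov_domain U = {p. fst (snd p) \<in> U \<and> chernov_S p \<noteq> 0 \<and>
     invertible ((\<chi> i j. d_y i (d_y j chernov_S) p) :: real^4^4)}"

definition metric_g :: "(real \<Rightarrow> real) \<Rightarrow> 4 \<Rightarrow> 4 \<Rightarrow> jet \<Rightarrow> real" where
  "metric_g h i j p = h (fst p) / 2 * d_y i (d_y j (\<lambda>q. (chernov_F h q)\<^sup>2)) p"

definition metric_g_inv :: "(real \<Rightarrow> real) \<Rightarrow> 4 \<Rightarrow> 4 \<Rightarrow> jet \<Rightarrow> real" where
  "metric_g_inv h j k p = matrix_inv (\<chi> i j. metric_g h i j p) $ j $ k"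


subsection \<open>The Cartan canonical connection\<close>

text \<open>In the coefficients the upper index is the last one: \<open>cartan_G h j k\<close> is \<open>G^k_j1\<close>,
  \<open>cartan_L h j k i\<close> is \<open>L^i_jk\<close> and \<open>cartan_C h j k i\<close> is \<open>C^i_j(k)\<close>.\<close>

definition cartan_G :: "(real \<Rightarrow> real) \<Rightarrow> 4 \<Rightarrow> 4 \<Rightarrow> jet \<Rightarrow> real" where
  "cartan_G h j k p = (\<Sum>m\<in>UNIV. metric_g_inv h k m p / 2 *
     dir_deriv (frame h Tm) (metric_g h m j) p)"

definition cartan_L :: "(real \<Rightarrow> real) \<Rightarrow> 4 \<Rightarrow> 4 \<Rightarrow> 4 \<Rightarrow> jet \<Rightarrow> real" where
  "cartan_L h j k i p = (\<Sum>m\<in>UNIV. metric_g_inv h i m p / 2 *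
     (dir_deriv (frame h (Hor k)) (metric_g h j m) p
      + dir_deriv (frame h (Hor j)) (metric_g h k m) p
      - dir_deriv (frame h (Hor m)) (metric_g h j k) p))"

definition cartan_C :: "(real \<Rightarrow> real) \<Rightarrow> 4 \<Rightarrow> 4 \<Rightarrow> 4 \<Rightarrow> jet \<Rightarrow> real" where
  "cartan_C h j k i p = (\<Sum>m\<in>UNIV. metric_g_inv h i m p / 2 *
     (d_y k (metric_g h j m) p + d_y j (metric_g h k m) p - d_y m (metric_g h j k) p))"

text \<open>\<open>cartan_table h A B\<close> is the covariant derivative of \<open>frame h B\<close> along \<open>frame h A\<close>.\<close>

fun cartan_table :: "(real \<Rightarrow> real) \<Rightarrow> adapted \<Rightarrow> adapted \<Rightarrow> vfield" where
  "cartan_table h Tm Tm p = varkappa h (fst p) *\<^sub>R frame h Tm p"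
| "cartan_table h Tm (Hor i) p = (\<Sum>k\<in>UNIV. cartan_G h i k p *\<^sub>R frame h (Hor k) p)"
| "cartan_table h Tm (Ver i) p =
     (\<Sum>k\<in>UNIV. (cartan_G h i k p - (if i = k then 1 else 0) * varkappa h (fst p)) *\<^sub>R frame h (Ver k) p)"
| "cartan_table h (Hor j) Tm p = 0"
| "cartan_table h (Hor j) (Hor i) p = (\<Sum>k\<in>UNIV. cartan_L h i j k p *\<^sub>R frame h (Hor k) p)"
| "cartan_table h (Hor j) (Ver i) p = (\<Sum>k\<in>UNIV. cartan_L h i j k p *\<^sub>R frame h (Ver k) p)"
| "cartan_table h (Ver j) Tm p = 0"
| "cartan_table h (Ver j) (Hor i) p = (\<Sum>k\<in>UNIV. cartan_C h i j k p *\<^sub>R frame h (Hor k) p)"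
| "cartan_table h (Ver j) (Ver i) p = (\<Sum>k\<in>UNIV. cartan_C h i j k p *\<^sub>R frame h (Ver k) p)"

text \<open>The linear connection with these values on the frame: the table is extended to all vector
  fields by function-linearity in \<open>X\<close> and the Leibniz rule in \<open>Y\<close> (see the lemmas below).\<close>

definition cartan_nabla :: "(real \<Rightarrow> real) \<Rightarrow> vfield \<Rightarrow> vfield \<Rightarrow> vfield" where
  "cartan_nabla h X Y p =
     (\<Sum>B\<in>UNIV. dir_deriv X (\<lambda>q. coframe h B q (Y q)) p *\<^sub>R frame h B p)
     + (\<Sum>A\<in>UNIV. \<Sum>B\<in>UNIV.
          (coframe h A p (X p) * coframe h B p (Y p)) *\<^sub>R cartan_table h A B p)"

lemma coframe_linear:
  "coframe h A p (c *\<^sub>R v) = c * coframe h A p v"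
  "coframe h A p (v + w) = coframe h A p v + coframe h A p w"
  by (cases p; cases v; cases w; cases A; simp add: algebra_simps)+

lemma varkappa_differentiable:
  assumes "riemannian_metric_R h"
  shows "varkappa h differentiable (at t)"
proof -
  have "(deriv ^^ 0) h differentiable (at t)" "(deriv ^^ 1) h differentiable (at t)" "h t > 0"
    using assms unfolding riemannian_metric_R_def by blast+
  then show ?thesis
    unfolding varkappa_def by (auto intro!: derivative_intros)
qed

lemma coframe_differentiable:
  assumes "riemannian_metric_R h" "Y differentiable (at p)"
  shows "(\<lambda>q. coframe h B q (Y q)) differentiable (at p)"
proof -
  have k: "(\<lambda>q::jet. varkappa h (fst q)) differentiable (at p)"
    by (rule differentiable_compose[OF varkappa_differentiable[OF assms(1)]])
       (auto intro: bounded_linear_imp_differentiable bounded_linear_fst)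
  have bl: "(\<lambda>q. f (Y q)) differentiable (at p)" if "bounded_linear f" for f :: "jet \<Rightarrow> real"
    using differentiable_compose[OF bounded_linear_imp_differentiable[OF that] assms(2)] .
  have fY: "(\<lambda>q. fst (Y q)) differentiable (at p)"
    by (intro bl bounded_linear_intros)
  have hY: "(\<lambda>q. fst (snd (Y q)) $ i) differentiable (at p)" for i
    by (intro bl bounded_linear_compose[OF bounded_linear_vec_nth] bounded_linear_intros)
  have vY: "(\<lambda>q. snd (snd (Y q)) $ i) differentiable (at p)" for i
    by (intro bl bounded_linear_compose[OF bounded_linear_vec_nth] bounded_linear_intros)
  have y: "(\<lambda>q::jet. snd (snd q) $ i) differentiable (at p)" for i
    by (intro bounded_linear_imp_differentiable bounded_linear_compose[OF bounded_linear_vec_nth]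
        bounded_linear_intros)
  have eq: "(\<lambda>q. coframe h B q (Y q)) = (case B of
      Tm \<Rightarrow> (\<lambda>q. fst (Y q)) | Hor i \<Rightarrow> (\<lambda>q. fst (snd (Y q)) $ i)
    | Ver i \<Rightarrow> (\<lambda>q. snd (snd (Y q)) $ i - varkappa h (fst q) * fst (Y q) * snd (snd q) $ i
         - (1/2) * varkappa h (fst q) * fst (snd (Y q)) $ i))"
  proof
    show "coframe h B q (Y q) = (case B of
      Tm \<Rightarrow> (\<lambda>q. fst (Y q)) | Hor i \<Rightarrow> (\<lambda>q. fst (snd (Y q)) $ i)
    | Ver i \<Rightarrow> (\<lambda>q. snd (snd (Y q)) $ i - varkappa h (fst q) * fst (Y q) * snd (snd q) $ i
         - (1/2) * varkappa h (fst q) * fst (snd (Y q)) $ i)) q" for q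
      by (cases q; cases "Y q"; cases B) auto
  qed
  show ?thesis
    unfolding eq using k fY hY vY y
    by (cases B) (auto intro!: differentiable_diff differentiable_mult differentiable_const)
qed

lemma cartan_nabla_frame:
  "cartan_nabla h (frame h A) (frame h B) p = cartan_table h A B p"
proof -
  have c: "dir_deriv (frame h A) (\<lambda>q. coframe h D q (frame h B q)) p = 0" for D
    by (simp add: coframe_frame dir_deriv_def frechet_derivative_const)
  have "(coframe h D p (frame h A p) * coframe h E p (frame h B p)) *\<^sub>R cartan_table h D E p
      = (if D = A then (if E = B then cartan_table h D E p else 0) else 0)" for D E
    by (simp add: coframe_frame)
  then have "(\<Sum>D\<in>UNIV. \<Sum>E\<in>UNIV.
      (coframe h D p (frame h A p) * coframe h E p (frame h B p)) *\<^sub>R cartan_table h D E p)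
      = (\<Sum>D\<in>UNIV. if D = A then cartan_table h D B p else 0)"
    by (intro sum.cong) (auto simp: sum.delta)
  then show ?thesis
    unfolding cartan_nabla_def c by (simp add: sum.delta)
qed

lemma dir_deriv_field:
  assumes "f differentiable (at p)"
  shows "dir_deriv (\<lambda>q. X q + Y q) f p = dir_deriv X f p + dir_deriv Y f p"
    and "dir_deriv (\<lambda>q. c q *\<^sub>R X q) f p = c p *\<^sub>R dir_deriv X f p"
  using linear_frechet_derivative[OF assms]
  by (simp_all add: dir_deriv_def linear_add linear_scale)

lemma cartan_nabla_field:
  assumes "riemannian_metric_R h" "Z differentiable (at p)"
  shows "cartan_nabla h (\<lambda>q. X q + Y q) Z p = cartan_nabla h X Z p + cartan_nabla h Y Z p"
    and "cartan_nabla h (\<lambda>q. c q *\<^sub>R X q) Z p = c p *\<^sub>R cartan_nabla h X Z p"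
  unfolding cartan_nabla_def
  by (simp_all add: dir_deriv_field[OF coframe_differentiable[OF assms]] coframe_linear
      scaleR_add_left scaleR_add_right sum.distrib scaleR_sum_right distrib_right mult.assoc)

lemma cartan_nabla_add:
  assumes "riemannian_metric_R h" "Y differentiable (at p)" "Z differentiable (at p)"
  shows "cartan_nabla h X (\<lambda>q. Y q + Z q) p = cartan_nabla h X Y p + cartan_nabla h X Z p"
proof -
  have "dir_deriv X (\<lambda>q. coframe h B q (Y q) + coframe h B q (Z q)) p
      = dir_deriv X (\<lambda>q. coframe h B q (Y q)) p + dir_deriv X (\<lambda>q. coframe h B q (Z q)) p" for B
    unfolding dir_deriv_def
    by (subst frechet_derivative_at[symmetric, OF has_derivative_add])
       (use assms in \<open>auto intro: frechet_derivative_works[THEN iffD1] coframe_differentiable\<close>)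
  then show ?thesis
    unfolding cartan_nabla_def
    by (simp add: coframe_linear scaleR_add_left sum.distrib distrib_left)
qed

lemma cartan_nabla_Leibniz:
  assumes "riemannian_metric_R h" "f differentiable (at p)" "Y differentiable (at p)"
  shows "cartan_nabla h X (\<lambda>q. f q *\<^sub>R Y q) p = dir_deriv X f p *\<^sub>R Y p + f p *\<^sub>R cartan_nabla h X Y p"
proof -
  have "dir_deriv X (\<lambda>q. f q * coframe h B q (Y q)) p
      = f p * dir_deriv X (\<lambda>q. coframe h B q (Y q)) p + dir_deriv X f p * coframe h B p (Y p)" for B
    unfolding dir_deriv_def
    by (subst frechet_derivative_at[symmetric, OF has_derivative_mult])
       (use assms in \<open>auto intro: frechet_derivative_works[THEN iffD1] coframe_differentiable\<close>)
  moreover have "(\<Sum>B\<in>UNIV. (dir_deriv X f p * coframe h B p (Y p)) *\<^sub>R frame h B p)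
      = dir_deriv X f p *\<^sub>R Y p"
    by (simp add: frame_expansion flip: scaleR_scaleR scaleR_sum_right)
  ultimately show ?thesis
    unfolding cartan_nabla_def
    by (simp add: coframe_linear scaleR_add_left scaleR_add_right sum.distrib scaleR_sum_right
        mult.left_commute mult.assoc algebra_simps)
qed


subsection \<open>Torsion\<close>

definition torsion :: "(real \<Rightarrow> real) \<Rightarrow> vfield \<Rightarrow> vfield \<Rightarrow> vfield" where
  "torsion h X Y p = cartan_nabla h X Y p - cartan_nabla h Y X p - lie_bracket X Y p"

definition torsion_component :: "(real \<Rightarrow> real) \<Rightarrow> adapted \<Rightarrow> adapted \<Rightarrow> adapted \<Rightarrow> jet \<Rightarrow> real" where
  "torsion_component h C A B p = coframe h C p (torsion h (frame h A) (frame h B) p)"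

datatype block = TB | HB | VB

fun block_of :: "adapted \<Rightarrow> block" where
  "block_of Tm = TB"
| "block_of (Hor i) = HB"
| "block_of (Ver i) = VB"

text \<open>A torsion d-tensor consists of the adapted components with a fixed kind (temporal, horizontal,
  vertical) for each index. As the torsion is antisymmetric, the two lower kinds are recorded as an
  unordered pair. A d-tensor is effective (does not vanish identically in general) if,
  for some temporal metric \<open>h\<close>, one of its components is nonzero at some point.\<close>

definition effective_torsions :: "(real^4) set \<Rightarrow> (block \<times> block set) set" where
  "effective_torsions U = {(block_of C, {block_of A, block_of B}) | A B C.
     \<exists>h. riemannian_metric_R h \<and> (\<exists>p\<in>chernov_domain U. torsion_component h C A B p \<noteq> 0)}"

end

theory Submission
  imports Defs
begin

text \<open>
  On the set where \<open>S \<noteq> 0\<close> one has \<open>g_ij = S_ij / (3 r) - S_i S_j / (9 r^4)\<close> with \<open>r\<close> the cube root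
  of \<open>S\<close>. Hence \<open>g\<close> depends on \<open>y\<close> only and is homogeneous of degree 0, so its derivative along
  \<open>\<delta>/\<delta>t\<close> vanishes and its derivative along \<open>\<delta>/\<delta>x^k\<close> is \<open>\<kappa>/2\<close> times that along \<open>\<partial>/\<partial>y^k\<close>.
  Therefore \<open>G = 0\<close> and \<open>L = \<kappa>/2 C\<close>, whatever the inverse of \<open>g\<close> is, and the torsion follows from the
  brackets of the adapted frame. All three d-tensors are nonzero for \<open>h = exp (2 t)\<close>, where
  \<open>\<kappa> = 1\<close>, at \<open>y = (1, 1, 1, 1)\<close>, where \<open>g\<close> is invertible and \<open>\<partial>g_ii/\<partial>y^i \<noteq> 0\<close>.
\<close>

section \<open>Directional derivatives on the jet chart\<close>

lemma dir_deriv_eq: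
  "(f has_derivative D) (at p) \<Longrightarrow> dir_deriv X f p = D (X p)"
  by (simp add: dir_deriv_def frechet_derivative_at[symmetric])

lemma d_y_eq:
  "(f has_derivative D) (at p) \<Longrightarrow> d_y i f p = D (0, 0, axis i 1)"
  by (simp add: d_y_def dir_deriv_eq)

text \<open>\<open>frechet_derivative\<close> is a choice from the \<open>has_derivative\<close>
  predicate, and that predicate is local. This allows a closed form valid only near \<open>p\<close>
  to be inserted under an outer derivative.\<close>

lemma d_y_cong_open:
  assumes "open A" "p \<in> A" "\<And>q. q \<in> A \<Longrightarrow> f q = g q"
  shows "d_y i f p = d_y i g p"
proof -
  have "(f has_derivative D) (at p) \<longleftrightarrow> (g has_derivative D) (at p)" for D
    using has_derivative_transform_within_open[of f D p UNIV A g]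
      has_derivative_transform_within_open[of g D p UNIV A f] assms by auto
  then show ?thesis
    by (simp add: d_y_def dir_deriv_def frechet_derivative_def)
qed

text \<open>A factor depending on t alone is constant in the y-directions; with \<open>a\<close> =
  1/h this pulls the temporal metric out of both derivatives of F^2.\<close>

lemma d_y_mult_fst:
  assumes "a differentiable (at (fst p))" "f differentiable (at p)"
  shows "d_y i (\<lambda>q. a (fst q) * f q) p = a (fst p) * d_y i f p"
proof -
  obtain a' f' where a': "(a has_derivative a') (at (fst p))" and f': "(f has_derivative f') (at p)"
    using assms by (auto simp: differentiable_def)
  have "((\<lambda>q. a (fst q)) has_derivative (\<lambda>v. a' (fst v))) (at p)"
    using has_derivative_compose[OF has_derivative_fst[OF has_derivative_ident] a'] .
  from d_y_eq[OF has_derivative_mult[OF this f']] d_y_eq[OF f'] show ?thesis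
    using has_derivative_linear[OF a'] by (simp add: linear_0)
qed

text \<open>The derivative along X at \<open>p\<close> is the velocity of f along the straight line
  through \<open>p\<close> with direction \<open>X p\<close>, so constancy on a short piece of that
  line is enough; no integral curve of X is needed.\<close>

lemma dir_deriv_eq_0:
  assumes "f differentiable (at p)"
    and "\<forall>\<^sub>F s in at 0. f (p + s *\<^sub>R X p) = f p"
  shows "dir_deriv X f p = (0::real)"
proof -
  obtain D where D: "(f has_derivative D) (at p)"
    using assms(1) by (auto simp: differentiable_def)
  have "((\<lambda>s. p + s *\<^sub>R X p) has_derivative (\<lambda>s. s *\<^sub>R X p)) (at 0)"
    by (auto intro!: derivative_eq_intros)
  then have "((\<lambda>s. f (p + s *\<^sub>R X p)) has_derivative (\<lambda>s. D (s *\<^sub>R X p))) (at 0)"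
    by (rule has_derivative_compose) (use D in simp)
  then have "((\<lambda>s. f p) has_derivative (\<lambda>s. D (s *\<^sub>R X p))) (at 0)"
    by (rule has_derivative_transform_eventually) (use assms(2) in auto)
  then have "(\<lambda>s. D (s *\<^sub>R X p)) = (\<lambda>s. 0)"
    using has_derivative_const has_derivative_unique by blast
  then have "D (1 *\<^sub>R X p) = 0"
    by metis
  then show ?thesis
    by (simp add: dir_deriv_eq[OF D])
qed


subsection \<open>Derivatives of the Chernov metric\<close>

text \<open>S is the elementary symmetric polynomial e_3, so its i-th derivative is e_2 of the other
  three variables, that is e_2 - y_i e_1 + y_i^2, with e_2 written through power sums. This form is
  uniform in the index i.\<close>

definition chernov_S1 :: "4 \<Rightarrow> real^4 \<Rightarrow> real" where
  "chernov_S1 i y =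
     ((\<Sum>k\<in>UNIV. y$k)\<^sup>2 - (\<Sum>k\<in>UNIV. (y$k)\<^sup>2)) / 2 - y$i * (\<Sum>k\<in>UNIV. y$k) + (y$i)\<^sup>2"

text \<open>The second derivatives of e_3: the sum of the two remaining variables off the diagonal,
  and 0 on it because e_3 is affine in each variable.\<close>

definition chernov_S2 :: "4 \<Rightarrow> 4 \<Rightarrow> real^4 \<Rightarrow> real" where
  "chernov_S2 i j y = (if i = j then 0 else (\<Sum>k\<in>UNIV. y$k) - y$i - y$j)"

lemma chernov_S2_commute: "chernov_S2 i j y = chernov_S2 j i y"
  by (simp add: chernov_S2_def)

lemma has_derivative_y_nth:
  "((\<lambda>q::jet. snd (snd q) $ i) has_derivative (\<lambda>v. snd (snd v) $ i)) (at p)"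
  by (intro bounded_linear_imp_has_derivative bounded_linear_compose[OF bounded_linear_vec_nth]
      bounded_linear_intros)

lemma chernov_S_eq:
  "chernov_S p = (let y = snd (snd p) in
     y$1 * y$2 * y$3 + y$1 * y$2 * y$4 + y$1 * y$3 * y$4 + y$2 * y$3 * y$4)"
  by (cases p) simp

lemma chernov_S1_simps:
  "chernov_S1 1 y = y$2 * y$3 + y$2 * y$4 + y$3 * y$4"
  "chernov_S1 2 y = y$1 * y$3 + y$1 * y$4 + y$3 * y$4"
  "chernov_S1 3 y = y$1 * y$2 + y$1 * y$4 + y$2 * y$4"
  "chernov_S1 4 y = y$1 * y$2 + y$1 * y$3 + y$2 * y$3"
  by (simp_all add: chernov_S1_def sum_4 power2_eq_square field_simps)

lemma has_derivative_chernov_S: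
  "(chernov_S has_derivative (\<lambda>v. \<Sum>j\<in>UNIV. chernov_S1 j (snd (snd p)) * snd (snd v) $ j)) (at p)"
  unfolding chernov_S_eq Let_def
  by (rule derivative_eq_intros has_derivative_y_nth refl)+
     (simp add: sum_4 chernov_S1_simps fun_eq_iff algebra_simps)

lemma has_derivative_chernov_S1:
  "((\<lambda>q::jet. chernov_S1 i (snd (snd q))) has_derivative
     (\<lambda>v. \<Sum>j\<in>UNIV. chernov_S2 i j (snd (snd p)) * snd (snd v) $ j)) (at p)"
  by (insert exhaust_4[of i], elim disjE;
      simp only: chernov_S1_simps, (rule derivative_eq_intros has_derivative_y_nth refl)+)
     (simp_all add: sum_4 chernov_S2_def fun_eq_iff algebra_simps)

lemma differentiable_chernov_S2: "(\<lambda>q::jet. chernov_S2 i j (snd (snd q))) differentiable (at p)"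
proof (cases "i = j")
  case False
  have "((\<lambda>q::jet. (\<Sum>k\<in>UNIV. snd (snd q) $ k) - snd (snd q) $ i - snd (snd q) $ j)
      has_derivative (\<lambda>v. (\<Sum>k\<in>UNIV. snd (snd v) $ k) - snd (snd v) $ i - snd (snd v) $ j)) (at p)"
    by (rule derivative_eq_intros has_derivative_y_nth refl)+
  then show ?thesis
    using False by (auto simp: chernov_S2_def differentiable_def)
qed (simp add: chernov_S2_def)

lemma open_chernov_S_nonzero: "open {q. chernov_S q \<noteq> 0}"
proof -
  have "continuous_on UNIV chernov_S"
    by (intro continuous_at_imp_continuous_on ballI has_derivative_continuous)
       (rule has_derivative_chernov_S)
  then show ?thesis
    by (intro open_Collect_neq) auto
qed

lemma d_y_chernov_S: "d_y i chernov_S p = chernov_S1 i (snd (snd p))"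
  by (simp add: d_y_eq[OF has_derivative_chernov_S] axis_def if_distrib cong: if_cong)

lemma d_y_d_y_chernov_S: "d_y i (d_y j chernov_S) p = chernov_S2 i j (snd (snd p))"
  by (simp add: d_y_chernov_S[abs_def] d_y_eq[OF has_derivative_chernov_S1] axis_def if_distrib
      chernov_S2_commute cong: if_cong)

text \<open>The chain rule with (s^(-1/3))' = - s^(-4/3) / 3. Fractional powers are written as
  integer powers of the inverse real cube root, which also makes sense for negative S.\<close>

lemma has_derivative_inverse_root_chernov_S:
  assumes "chernov_S p \<noteq> 0"
  shows "((\<lambda>q. inverse (root 3 (chernov_S q))) has_derivative
     (\<lambda>v. - (inverse (root 3 (chernov_S p)) ^ 4) / 3 *
       (\<Sum>j\<in>UNIV. chernov_S1 j (snd (snd p)) * snd (snd v) $ j))) (at p)"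
proof -
  have "((\<lambda>s. inverse (root 3 s)) has_real_derivative - (inverse (root 3 s) ^ 4) / 3) (at s)"
    if "s \<noteq> 0" for s
    using that
    by (auto intro!: derivative_eq_intros DERIV_odd_real_root simp: power_numeral_reduce field_simps)
  then show ?thesis
    using has_derivative_compose[OF has_derivative_chernov_S] assms
    unfolding has_field_derivative_def by blast
qed

lemma has_derivative_root_chernov_S_square:
  assumes "chernov_S p \<noteq> 0"
  shows "((\<lambda>q. (root 3 (chernov_S q))\<^sup>2) has_derivative
     (\<lambda>v. 2 / 3 * inverse (root 3 (chernov_S p)) *
       (\<Sum>j\<in>UNIV. chernov_S1 j (snd (snd p)) * snd (snd v) $ j))) (at p)"
proof -
  have "((\<lambda>s. (root 3 s)\<^sup>2) has_real_derivative 2 / 3 * inverse (root 3 s)) (at s)"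
    if "s \<noteq> 0" for s
    using that
    by (auto intro!: derivative_eq_intros DERIV_odd_real_root simp: power_numeral_reduce field_simps)
  then show ?thesis
    using has_derivative_compose[OF has_derivative_chernov_S] assms
    unfolding has_field_derivative_def by blast
qed

section \<open>Closed form of the fundamental metrical d-tensor\<close>

definition chernov_g :: "4 \<Rightarrow> 4 \<Rightarrow> jet \<Rightarrow> real" where
  "chernov_g i j q = chernov_S2 i j (snd (snd q)) * inverse (root 3 (chernov_S q)) / 3
     - chernov_S1 i (snd (snd q)) * chernov_S1 j (snd (snd q)) * inverse (root 3 (chernov_S q)) ^ 4 / 9"

lemma chernov_g_commute: "chernov_g i j = chernov_g j i"
  by (simp add: chernov_g_def fun_eq_iff chernov_S2_commute)

text \<open>Since F^2 = S^(2/3) / h, the prefactor h cancels and what remains is half the y-Hessian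
  of S^(2/3).\<close>

lemma metric_g_eq:
  assumes "riemannian_metric_R h" "chernov_S p \<noteq> 0"
  shows "metric_g h i j p = chernov_g i j p"
proof -
  let ?r = "\<lambda>q. root 3 (chernov_S q)"
  let ?f = "\<lambda>q. 2 / 3 * (inverse (?r q) * chernov_S1 j (snd (snd q)))"
  have pos: "h t > 0" for t
    using assms(1) by (auto simp: riemannian_metric_R_def)
  have "h differentiable (at t)" for t
    using assms(1) unfolding riemannian_metric_R_def by (metis funpow_0)
  \<comment> \<open>\<open>d_y\<close> is read off from the derivative on the whole jet space, so
    1/h must be differentiable in t although only y-directions are evaluated.\<close>
  then have dh: "(\<lambda>t. 1 / h t) differentiable (at t)" for t
    using pos[of t] by (auto intro!: derivative_intros)
  have F: "(\<lambda>q. (chernov_F h q)\<^sup>2) = (\<lambda>q. 1 / h (fst q) * (?r q)\<^sup>2)"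
    using pos by (auto simp: chernov_F_def power_mult_distrib less_imp_le)
  have "d_y j (\<lambda>q. (chernov_F h q)\<^sup>2) q = 1 / h (fst q) * ?f q" if "chernov_S q \<noteq> 0" for q
  proof -
    have "(\<lambda>q. (?r q)\<^sup>2) differentiable (at q)"
      using has_derivative_root_chernov_S_square[OF that] by (auto simp: differentiable_def)
    from d_y_mult_fst[OF dh this]
    have "d_y j (\<lambda>q. (chernov_F h q)\<^sup>2) q = 1 / h (fst q) * d_y j (\<lambda>q. (?r q)\<^sup>2) q"
      by (simp add: F)
    also have "d_y j (\<lambda>q. (?r q)\<^sup>2) q = ?f q"
      by (simp add: d_y_eq[OF has_derivative_root_chernov_S_square[OF that]] axis_def if_distrib
          cong: if_cong)
    finally show ?thesis .
  qed
  then have "d_y i (d_y j (\<lambda>q. (chernov_F h q)\<^sup>2)) p = d_y i (\<lambda>q. 1 / h (fst q) * ?f q) p"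
    by (intro d_y_cong_open[OF open_chernov_S_nonzero]) (use assms in auto)
  also have "\<dots> = 1 / h (fst p) * d_y i ?f p"
    by (intro d_y_mult_fst dh differentiable_mult differentiable_const)
       (use has_derivative_inverse_root_chernov_S[OF assms(2)] has_derivative_chernov_S1[of j p]
         in \<open>unfold differentiable_def, blast+\<close>)
  also have "d_y i ?f p = 2 * chernov_g i j p"
    by (subst d_y_eq[OF has_derivative_mult_right[OF has_derivative_mult[OF
          has_derivative_inverse_root_chernov_S[OF assms(2)] has_derivative_chernov_S1]]])
       (simp add: chernov_g_def axis_def if_distrib chernov_S2_commute[of j i] algebra_simps
         cong: if_cong)
  finally show ?thesis
    using pos[of "fst p"] by (simp add: metric_g_def)
qed

lemma has_derivative_metric_g:
  assumes "riemannian_metric_R h" "chernov_S p \<noteq> 0" "(chernov_g i j has_derivative D) (at p)"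
  shows "(metric_g h i j has_derivative D) (at p)"
  by (rule has_derivative_transform_within_open[OF assms(3) open_chernov_S_nonzero])
     (use assms in \<open>auto simp: metric_g_eq\<close>)

lemma differentiable_metric_g:
  assumes "riemannian_metric_R h" "chernov_S p \<noteq> 0"
  shows "metric_g h i j differentiable (at p)"
proof -
  have "(\<lambda>q. inverse (root 3 (chernov_S q))) differentiable (at p)"
       "(\<lambda>q::jet. chernov_S1 i (snd (snd q))) differentiable (at p)" for i
    using has_derivative_inverse_root_chernov_S[OF assms(2)] has_derivative_chernov_S1[of _ p]
    unfolding differentiable_def by blast+
  then have "chernov_g i j differentiable (at p)"
    unfolding chernov_g_def[abs_def] divide_inverse
    by (intro differentiable_diff differentiable_mult differentiable_power differentiable_const
        differentiable_chernov_S2)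
  then show ?thesis
    using has_derivative_metric_g[OF assms] by (auto simp: differentiable_def)
qed

section \<open>Homogeneity of the metric and its derivatives along the adapted frame\<close>

lemma chernov_S_scale: "chernov_S (t, x, c *\<^sub>R y) = c ^ 3 * chernov_S (t', x', y)"
  by (simp add: eval_nat_numeral algebra_simps)

text \<open>S_i, S_ij and the cube root of S have degrees 2, 1 and 1, so both terms have degree 0;
  the odd root admits negative c as well. Leaving t, x and t', x' unrelated adds independence of
  time and position.\<close>

lemma chernov_g_scale:
  assumes "c \<noteq> 0"
  shows "chernov_g i j (t, x, c *\<^sub>R y) = chernov_g i j (t', x', y)"
proof -
  have "chernov_S1 i (c *\<^sub>R y) = c\<^sup>2 * chernov_S1 i y" "chernov_S2 i j (c *\<^sub>R y) = c * chernov_S2 i j y" for i j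
    by (simp_all add: chernov_S1_def chernov_S2_def sum_4 power2_eq_square algebra_simps)
  moreover have "root 3 (chernov_S (t, x, c *\<^sub>R y)) = c * root 3 (chernov_S (t', x', y))"
    unfolding chernov_S_scale[of t x c y t' x'] by (simp add: real_root_mult odd_real_root_power_cancel)
  ultimately show ?thesis
    using assms by (simp add: chernov_g_def power_numeral_reduce field_simps del: chernov_S.simps)
qed

lemma metric_g_scale:
  assumes "riemannian_metric_R h" "chernov_S (t', x', y) \<noteq> 0" "c \<noteq> 0"
  shows "metric_g h i j (t, x, c *\<^sub>R y) = metric_g h i j (t', x', y)"
  using assms chernov_S_scale[of t x c y t' x']
  by (simp add: metric_g_eq chernov_g_scale[of c i j t x y t' x'] del: chernov_S.simps)

text \<open>The line through (t, x, y) in direction \<delta>/\<delta>t only shifts t and rescales y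
  by 1 + s \<kappa>, which is nonzero for small s; a function of degree 0 in y alone is constant on
  it.\<close>

lemma dir_deriv_Tm_metric_g:
  assumes "riemannian_metric_R h" "chernov_S p \<noteq> 0"
  shows "dir_deriv (frame h Tm) (metric_g h i j) p = 0"
proof (rule dir_deriv_eq_0[OF differentiable_metric_g[OF assms]])
  obtain t x y where p: "p = (t, x, y)"
    by (cases p)
  have "((\<lambda>s. 1 + s * varkappa h t) \<longlongrightarrow> 1 + 0 * varkappa h t) (at 0)"
    by (intro tendsto_intros)
  then have "\<forall>\<^sub>F s in at 0. 1 + s * varkappa h t \<noteq> 0"
    by (rule tendsto_imp_eventually_ne) simp
  then show "\<forall>\<^sub>F s in at 0. metric_g h i j (p + s *\<^sub>R frame h Tm p) = metric_g h i j p"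
  proof eventually_elim
    case (elim s)
    have "p + s *\<^sub>R frame h Tm p = (t + s, x, (1 + s * varkappa h t) *\<^sub>R y)"
      by (simp add: p scaleR_add_left)
    then show ?case
      using metric_g_scale[OF assms(1) _ elim] assms(2) by (simp add: p del: chernov_S.simps)
  qed
qed

lemma dir_deriv_Hor_metric_g:
  assumes "riemannian_metric_R h" "chernov_S p \<noteq> 0"
  shows "dir_deriv (frame h (Hor k)) (metric_g h i j) p = varkappa h (fst p) / 2 * d_y k (metric_g h i j) p"
proof -
  obtain t x y where p: "p = (t, x, y)"
    by (cases p)
  let ?X = "\<lambda>p::jet. (0, axis k 1, 0) :: jet" and ?Y = "\<lambda>p::jet. (0, 0, axis k 1) :: jet"
  note d = differentiable_metric_g[OF assms]
  have "dir_deriv (frame h (Hor k)) (metric_g h i j) p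
      = dir_deriv (\<lambda>q. ?X q + (varkappa h (fst q) / 2) *\<^sub>R ?Y q) (metric_g h i j) p"
    by (simp add: dir_deriv_def p)
  also have "\<dots> = dir_deriv ?X (metric_g h i j) p + varkappa h (fst p) / 2 * d_y k (metric_g h i j) p"
    unfolding dir_deriv_field[OF d] by (simp add: d_y_def)
  \<comment> \<open>Scaling by the factor 1 expresses that the metric does not depend on x.\<close>
  also have "dir_deriv ?X (metric_g h i j) p = 0"
    by (rule dir_deriv_eq_0[OF d], rule always_eventually)
       (use metric_g_scale[OF assms(1), of t x y 1] assms(2) in \<open>simp add: p del: chernov_S.simps\<close>)
  finally show ?thesis by simp
qed

text \<open>\<open>metric_g\<close> is an iterated derivative, so its symmetry is read off from the
  closed form near \<open>p\<close>.\<close>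

lemma d_y_metric_g_commute:
  assumes "riemannian_metric_R h" "chernov_S p \<noteq> 0"
  shows "d_y k (metric_g h i j) p = d_y k (metric_g h j i) p"
  by (rule d_y_cong_open[OF open_chernov_S_nonzero])
     (use assms in \<open>auto simp: metric_g_eq chernov_g_commute[of i j]\<close>)

section \<open>The coefficients of the Cartan connection\<close>

lemma cartan_G_eq_0:
  assumes "riemannian_metric_R h" "chernov_S p \<noteq> 0"
  shows "cartan_G h j k p = 0"
  by (simp add: cartan_G_def dir_deriv_Tm_metric_g[OF assms])

lemma cartan_L_eq:
  assumes "riemannian_metric_R h" "chernov_S p \<noteq> 0"
  shows "cartan_L h j k i p = varkappa h (fst p) / 2 * cartan_C h j k i p"
  unfolding cartan_L_def cartan_C_def dir_deriv_Hor_metric_g[OF assms] sum_distrib_left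
  by (intro sum.cong) (simp_all add: algebra_simps)

text \<open>Together with L = \<kappa>/2 C, this symmetry cancels the purely horizontal and purely
  vertical torsion.\<close>

lemma cartan_C_commute:
  assumes "riemannian_metric_R h" "chernov_S p \<noteq> 0"
  shows "cartan_C h j k i p = cartan_C h k j i p"
  unfolding cartan_C_def d_y_metric_g_commute[OF assms, of _ j k]
  by (simp add: add.commute)


subsection \<open>Brackets and torsion of the adapted frame\<close>

lemma has_derivative_varkappa_fst:
  assumes "riemannian_metric_R h"
  shows "((\<lambda>q::jet. varkappa h (fst q)) has_derivative (\<lambda>v. deriv (varkappa h) (fst p) * fst v)) (at p)"
proof -
  have "(varkappa h has_derivative (*) (deriv (varkappa h) (fst p))) (at (fst p))"
    using varkappa_differentiable[OF assms, of "fst p"]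
    by (metis DERIV_deriv_iff_real_differentiable has_field_derivative_def)
  from has_derivative_compose[OF has_derivative_fst[OF has_derivative_ident] this] show ?thesis .
qed

lemma has_derivative_frame:
  assumes "riemannian_metric_R h"
  shows "(frame h Tm has_derivative (\<lambda>v. (0, 0, varkappa h (fst p) *\<^sub>R snd (snd v)
           + (deriv (varkappa h) (fst p) * fst v) *\<^sub>R snd (snd p)))) (at p)"
    and "(frame h (Hor i) has_derivative
           (\<lambda>v. (0, 0, (deriv (varkappa h) (fst p) * fst v / 2) *\<^sub>R axis i 1))) (at p)"
    and "(frame h (Ver i) has_derivative (\<lambda>v. 0)) (at p)"
proof -
  note [derivative_intros] = has_derivative_varkappa_fst[OF assms]
  have "frame h Tm = (\<lambda>q. (1, 0, varkappa h (fst q) *\<^sub>R snd (snd q)))"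
    "frame h (Hor i) = (\<lambda>q. (0, axis i 1, (varkappa h (fst q) * (1 / 2)) *\<^sub>R axis i 1))"
    "frame h (Ver i) = (\<lambda>q. (0, 0, axis i 1))"
    by auto
  note eqs = this
  show "(frame h Tm has_derivative (\<lambda>v. (0, 0, varkappa h (fst p) *\<^sub>R snd (snd v)
           + (deriv (varkappa h) (fst p) * fst v) *\<^sub>R snd (snd p)))) (at p)"
    "(frame h (Hor i) has_derivative
           (\<lambda>v. (0, 0, (deriv (varkappa h) (fst p) * fst v / 2) *\<^sub>R axis i 1))) (at p)"
    "(frame h (Ver i) has_derivative (\<lambda>v. 0)) (at p)"
    unfolding eqs by (auto intro!: derivative_eq_intros simp: zero_prod_def)
qed

text \<open>Apart from the factor y in \<open>frame h Tm\<close>, the frame coefficients depend on t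
  only, so every bracket is vertical. In the bracket of \<delta>/\<delta>x^j with
  \<delta>/\<delta>t, \<kappa>^2/2 comes from applying the vertical part of \<delta>/\<delta>x^j to
  \<kappa> y, and \<kappa>'/2 from differentiating the coefficient \<kappa>/2 in t.\<close>

lemma lie_bracket_frame:
  assumes "riemannian_metric_R h"
  shows "lie_bracket (frame h (Ver j)) (frame h (Hor i)) p = 0"
    and "lie_bracket (frame h (Hor j)) (frame h Tm) p
      = (1 / 2 * ((varkappa h (fst p))\<^sup>2 - deriv (varkappa h) (fst p))) *\<^sub>R frame h (Ver j) p"
    and "lie_bracket (frame h Tm) (frame h (Ver i)) p = - varkappa h (fst p) *\<^sub>R frame h (Ver i) p"
    and "lie_bracket (frame h (Hor i)) (frame h (Hor j)) p = 0"
    and "lie_bracket (frame h (Ver i)) (frame h (Ver j)) p = 0"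
  by (cases p; simp add: lie_bracket_def dir_deriv_eq[OF has_derivative_frame(1)[OF assms]]
      dir_deriv_eq[OF has_derivative_frame(2)[OF assms]]
      dir_deriv_eq[OF has_derivative_frame(3)[OF assms]] zero_prod_def power2_eq_square
      algebra_simps flip: scaleR_add_left scaleR_diff_left)+

lemma torsion_antisym: "torsion h X Y p = - torsion h Y X p"
  by (simp add: torsion_def lie_bracket_def)

text \<open>For \<open>Ver\<close>, \<open>Hor\<close> the bracket is 0: C comes from
  differentiating the horizontal field, and - \<kappa>/2 C is -L from differentiating the vertical
  one. For \<open>Hor\<close>, \<open>Tm\<close> both covariant derivatives vanish, as G = 0,
  leaving minus the bracket. For \<open>Tm\<close>, \<open>Ver\<close> the term - \<kappa> in the
  connection cancels the bracket.\<close>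

lemma torsion_frame:
  assumes "riemannian_metric_R h" "chernov_S p \<noteq> 0"
  shows "torsion h (frame h (Ver j)) (frame h (Hor i)) p =
           (\<Sum>k\<in>UNIV. cartan_C h i j k p *\<^sub>R frame h (Hor k) p)
         + (\<Sum>k\<in>UNIV. (- 1 / 2 * varkappa h (fst p) * cartan_C h i j k p) *\<^sub>R frame h (Ver k) p)"
    and "torsion h (frame h (Hor j)) (frame h Tm) p =
           (\<Sum>k\<in>UNIV. (1 / 2 * (deriv (varkappa h) (fst p) - varkappa h (fst p) * varkappa h (fst p))
             * (if j = k then 1 else 0)) *\<^sub>R frame h (Ver k) p)"
    and "torsion h (frame h Tm) (frame h Tm) p = 0"
    and "torsion h (frame h Tm) (frame h (Ver i)) p = 0"
    and "torsion h (frame h (Hor i)) (frame h (Hor j)) p = 0"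
    and "torsion h (frame h (Ver i)) (frame h (Ver j)) p = 0"
proof -
  have delta: "(\<Sum>k\<in>UNIV. (c * (if j = k then 1 else 0)) *\<^sub>R frame h (Ver k) p) = c *\<^sub>R frame h (Ver j) p"
    for c j
    by (simp add: if_distrib[of "\<lambda>x. x *\<^sub>R _"] if_distrib[of "\<lambda>x. _ * x"] cong: if_cong)
  \<comment> \<open>The 0 stands where \<open>cartan_G\<close> was, so that the left side matches
    the rewritten table entry.\<close>
  have delta': "(\<Sum>k\<in>UNIV. (0 - (if i = k then 1 else 0) * c) *\<^sub>R frame h (Ver k) p) = - c *\<^sub>R frame h (Ver i) p"
    for c
    using delta[of "-c" i] by (simp add: mult.commute)
  note defs = torsion_def cartan_nabla_frame cartan_table.simps lie_bracket_frame[OF assms(1)]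
    cartan_G_eq_0[OF assms] cartan_L_eq[OF assms]
  show "torsion h (frame h (Ver j)) (frame h (Hor i)) p =
           (\<Sum>k\<in>UNIV. cartan_C h i j k p *\<^sub>R frame h (Hor k) p)
         + (\<Sum>k\<in>UNIV. (- 1 / 2 * varkappa h (fst p) * cartan_C h i j k p) *\<^sub>R frame h (Ver k) p)"
    unfolding defs cartan_C_commute[OF assms, of j i] by (simp add: sum_negf)
  show "torsion h (frame h (Hor j)) (frame h Tm) p =
           (\<Sum>k\<in>UNIV. (1 / 2 * (deriv (varkappa h) (fst p) - varkappa h (fst p) * varkappa h (fst p))
             * (if j = k then 1 else 0)) *\<^sub>R frame h (Ver k) p)"
    unfolding delta defs by (simp add: power2_eq_square algebra_simps flip: scaleR_minus_left)
  show "torsion h (frame h Tm) (frame h Tm) p = 0"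
    by (simp add: torsion_def lie_bracket_def)
  show "torsion h (frame h Tm) (frame h (Ver i)) p = 0"
    unfolding defs delta' by simp
  show "torsion h (frame h (Hor i)) (frame h (Hor j)) p = 0"
    unfolding defs cartan_C_commute[OF assms, of j i] by simp
  show "torsion h (frame h (Ver i)) (frame h (Ver j)) p = 0"
    unfolding defs cartan_C_commute[OF assms, of j i] by simp
qed

section \<open>Adapted components of the torsion\<close>

lemma coframe_0: "coframe h A p 0 = 0"
  using coframe_linear(1)[of h A p 0 0] by simp

lemma coframe_sum: "coframe h A p (\<Sum>k\<in>I. f k *\<^sub>R v k) = (\<Sum>k\<in>I. f k * coframe h A p (v k))"
  by (induction I rule: infinite_finite_induct) (simp_all add: coframe_linear coframe_0)

lemma torsion_component_antisym: "torsion_component h C A B p = - torsion_component h C B A p"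
  unfolding torsion_component_def
  using coframe_linear(1)[of h C p "-1"] torsion_antisym[of h "frame h A" "frame h B" p] by simp

lemma torsion_component_frame:
  assumes "riemannian_metric_R h" "chernov_S p \<noteq> 0"
  shows "torsion_component h Tm (Ver j) (Hor i) p = 0"
    and "torsion_component h (Hor k) (Ver j) (Hor i) p = cartan_C h i j k p"
    and "torsion_component h (Ver k) (Ver j) (Hor i) p = - 1 / 2 * varkappa h (fst p) * cartan_C h i j k p"
    and "torsion_component h Tm (Hor j) Tm p = 0"
    and "torsion_component h (Hor k) (Hor j) Tm p = 0"
    and "torsion_component h (Ver k) (Hor j) Tm p =
      1 / 2 * (deriv (varkappa h) (fst p) - varkappa h (fst p) * varkappa h (fst p)) * (if j = k then 1 else 0)"
    and "torsion_component h C Tm Tm p = 0"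
    and "torsion_component h C Tm (Ver i) p = 0"
    and "torsion_component h C (Hor i) (Hor j) p = 0"
    and "torsion_component h C (Ver i) (Ver j) p = 0"
  unfolding torsion_component_def torsion_frame[OF assms] coframe_linear coframe_sum coframe_frame coframe_0
  by (simp_all add: if_distrib[of "\<lambda>x. _ * x"] cong: if_cong)

lemma torsion_component_nonzero_blocks:
  assumes "riemannian_metric_R h" "chernov_S p \<noteq> 0" "torsion_component h C A B p \<noteq> 0"
  shows "(block_of C, {block_of A, block_of B}) \<in> {(VB, {HB, VB}), (HB, {HB, VB}), (VB, {TB, HB})}"
proof -
  \<comment> \<open>The component formulas cover one order of each pair of lower indices; having
    both orders lets them decide every case.\<close>
  have "torsion_component h C A B p \<noteq> 0" "torsion_component h C B A p \<noteq> 0"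
    using assms(3) torsion_component_antisym[of h C A B p] by auto
  then show ?thesis
    by (cases A; cases B; cases C)
       (simp_all add: torsion_component_frame[OF assms(1,2)] insert_commute)
qed


subsection \<open>A point where the torsion does not vanish\<close>

lemma invertible_diag_plus_const:
  fixes a b :: real
  assumes "a \<noteq> b" "a + 3 * b \<noteq> 0"
  shows "invertible ((\<chi> i j. if i = j then a else b) :: real^4^4)"
proof -
  \<comment> \<open>The matrix is (a - b) I + b J with J the all-ones matrix, with eigenvalues a - b
    and a + 3 b. Its inverse has the same shape: I / (a - b) + d J, with diagonal entry
    \<open>c\<close> and off-diagonal entry \<open>d\<close>.\<close>
  define d where "d = - b / ((a - b) * (a + 3 * b))"
  define c where "c = 1 / (a - b) + d"
  have *: "a * c + 3 * b * d = 1" "a * d + b * c + 2 * b * d = 0"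
    using assms unfolding c_def d_def by (simp_all add: divide_simps) (simp_all add: algebra_simps)
  have "((\<chi> i j. if i = j then a else b) :: real^4^4) ** (\<chi> i j. if i = j then c else d) = mat 1"
    using * by (simp add: matrix_matrix_mult_def mat_def vec_eq_iff forall_4 sum_4 algebra_simps)
  then show ?thesis
    by (auto simp: invertible_right_inverse)
qed

lemma matrix_mult_matrix_inv: "invertible A \<Longrightarrow> A ** matrix_inv A = mat 1"
  unfolding matrix_inv_def invertible_def by (metis (mono_tags, lifting) someI_ex)

text \<open>Lowering the upper index with the invertible g loses nothing, and the lowered
  coefficient with all three indices equal to j is half of \<partial>g_jj/\<partial>y^j.\<close>

lemma cartan_C_nonzero:
  assumes "invertible (\<chi> i j. metric_g h i j p)" "d_y j (metric_g h j j) p \<noteq> 0"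
  obtains k where "cartan_C h j j k p \<noteq> 0"
proof (rule ccontr)
  assume "\<not> thesis"
  then have C: "cartan_C h j j k p = 0" for k
    using that by blast
  let ?g = "(\<chi> i j. metric_g h i j p) :: real^4^4"
  define w :: "real^4" where "w = (\<chi> m. (d_y j (metric_g h j m) p + d_y j (metric_g h j m) p
     - d_y m (metric_g h j j) p) / 2)"
  have "matrix_inv ?g *v w = 0"
    using C by (simp add: vec_eq_iff matrix_vector_mult_def w_def cartan_C_def metric_g_inv_def)
  then have "(?g ** matrix_inv ?g) *v w = 0"
    by (simp flip: matrix_vector_mul_assoc)
  then have "w $ j = 0"
    by (simp add: matrix_mult_matrix_inv[OF assms(1)])
  then show False
    using assms(2) by (simp add: w_def)
qed

lemma chernov_ones:
  "chernov_S (t, x, 1) = 4" "chernov_S1 i 1 = 3" "chernov_S2 i j 1 = (if i = j then 0 else 2)"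
  by (simp_all add: chernov_S1_def chernov_S2_def)

lemma ones_in_chernov_domain:
  assumes "x \<in> U"
  shows "(t, x, 1) \<in> chernov_domain U"
  \<comment> \<open>The Hessian of S at (1, 1, 1, 1) has 0 on the diagonal and 2 elsewhere.\<close>
  using assms invertible_diag_plus_const[of 0 2]
  by (simp add: chernov_domain_def d_y_d_y_chernov_S chernov_ones del: chernov_S.simps)

lemma invertible_metric_g_ones:
  assumes "riemannian_metric_R h"
  shows "invertible (\<chi> i j. metric_g h i j (t, x, 1))"
proof -
  define r where "r = inverse (root 3 (4::real))"
  have r: "r \<noteq> 0" "r ^ 3 = 1 / 4"
    by (simp_all add: r_def power_inverse)
  then have r4: "r ^ 4 = r / 4"
    by (simp add: eval_nat_numeral)
  \<comment> \<open>Here S = 4 and S_i = 3: the diagonal is - r^4 and the rest 2/3 r - r^4, with r^4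
    = r/4. The two eigenvalues are - 2/3 r and r.\<close>
  have "metric_g h i j (t, x, 1) = (if i = j then - r / 4 else 5 / 12 * r)" for i j
    by (simp add: metric_g_eq assms chernov_g_def chernov_ones r_def[symmetric] r4 del: chernov_S.simps)
  then show ?thesis
    using invertible_diag_plus_const[of "- r / 4" "5 / 12 * r"] r(1) by simp
qed

text \<open>As S_ii = 0, g_ii is - S_i^2 S^(-4/3) / 9, and S_i does not involve y^i. Only S^(-4/3)
  is differentiated, which gives 4 S^(-7/3) at S = 4, S_i = 3.\<close>

lemma d_y_metric_g_ones:
  assumes "riemannian_metric_R h"
  shows "d_y i (metric_g h i i) (t, x, 1) \<noteq> 0"
proof -
  let ?p = "(t, x, 1) :: jet"
  have p: "chernov_S ?p \<noteq> 0"
    using chernov_ones(1)[of t x] by linarith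
  have g: "chernov_g i i = (\<lambda>q. - 1 / 9 * (chernov_S1 i (snd (snd q)) ^ 2 * inverse (root 3 (chernov_S q)) ^ 4))"
    by (auto simp: chernov_g_def chernov_S2_def power2_eq_square)
  note D = has_derivative_mult_right[of _ _ _ "- 1 / 9", OF has_derivative_mult[OF
      has_derivative_power[OF has_derivative_chernov_S1[of i]]
      has_derivative_power[OF has_derivative_inverse_root_chernov_S[OF p]]], of 2 4, folded g]
  have "d_y i (metric_g h i i) ?p = 4 * inverse (root 3 4) ^ 7"
    by (subst d_y_eq[OF has_derivative_metric_g[OF assms p D]])
       (simp add: chernov_ones axis_def if_distrib eval_nat_numeral cong: if_cong del: chernov_S.simps)
  then show ?thesis by simp
qed

text \<open>A constant \<kappa> = 1 makes both - \<kappa>/2 and (\<kappa>' - \<kappa>^2)/2 equal to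
  - 1/2, so neither coefficient vanishes.\<close>

lemma exp_double_metric:
  shows "riemannian_metric_R (\<lambda>t. exp (2 * t))" and "varkappa (\<lambda>t. exp (2 * t)) = (\<lambda>t. 1)"
proof -
  have d: "((\<lambda>t. c * exp (2 * t)) has_real_derivative 2 * c * exp (2 * t)) (at t)" for c t :: real
    by (auto intro!: derivative_eq_intros)
  have "(deriv ^^ n) (\<lambda>t. exp (2 * t)) = (\<lambda>t::real. 2 ^ n * exp (2 * t))" for n
    by (induction n) (auto simp: DERIV_imp_deriv[OF d])
  then show "riemannian_metric_R (\<lambda>t. exp (2 * t))"
    unfolding riemannian_metric_R_def using d real_differentiable_def by auto
  show "varkappa (\<lambda>t. exp (2 * t)) = (\<lambda>t. 1)"
    using DERIV_imp_deriv[OF d, of 1] by (auto simp: varkappa_def)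
qed

section \<open>Determination of the effective torsion d-tensors\<close>

lemma effective_torsions_eq:
  assumes "U \<noteq> {}"
  shows "effective_torsions U = {(VB, {HB, VB}), (HB, {HB, VB}), (VB, {TB, HB})}"
proof
  show "effective_torsions U \<subseteq> {(VB, {HB, VB}), (HB, {HB, VB}), (VB, {TB, HB})}"
  proof
    fix z assume "z \<in> effective_torsions U"
    then obtain A B C h p where z: "z = (block_of C, {block_of A, block_of B})"
      and h: "riemannian_metric_R h" and p: "p \<in> chernov_domain U"
      and nz: "torsion_component h C A B p \<noteq> 0"
      unfolding effective_torsions_def by blast
    from p have "chernov_S p \<noteq> 0"
      by (simp add: chernov_domain_def)
    from torsion_component_nonzero_blocks[OF h this nz]
    show "z \<in> {(VB, {HB, VB}), (HB, {HB, VB}), (VB, {TB, HB})}"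
      unfolding z .
  qed
next
  obtain x where "x \<in> U"
    using assms by blast
  define p :: jet where "p = (0, x, 1)"
  have p: "p \<in> chernov_domain U" "chernov_S p \<noteq> 0"
    using ones_in_chernov_domain[OF \<open>x \<in> U\<close>, of 0] by (simp_all add: p_def chernov_domain_def)
  let ?h = "\<lambda>t. exp (2 * t) :: real"
  note h = exp_double_metric(1)
  obtain k where k: "cartan_C ?h 1 1 k p \<noteq> 0"
    using cartan_C_nonzero[OF invertible_metric_g_ones[OF h] d_y_metric_g_ones[OF h]]
    unfolding p_def by blast
  have eff: "(block_of C, {block_of A, block_of B}) \<in> effective_torsions U"
    if "torsion_component ?h C A B p \<noteq> 0" for A B C
    unfolding effective_torsions_def using h p that by blast
  show "{(VB, {HB, VB}), (HB, {HB, VB}), (VB, {TB, HB})} \<subseteq> effective_torsions U"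
    \<comment> \<open>The upper index comes first. The three components have the values C, - C/2 and
      - 1/2, where C is the nonzero coefficient found above.\<close>
    using eff[of "Hor k" "Ver 1" "Hor 1"] eff[of "Ver k" "Ver 1" "Hor 1"] eff[of "Ver 1" "Hor 1" Tm] k
    by (simp add: torsion_component_frame[OF h p(2)] exp_double_metric(2) insert_commute)
qed

theorem theorem4p3:
  fixes h :: "real \<Rightarrow> real" and U :: "(real^4) set"
  assumes "riemannian_metric_R h" and "open U" and "U \<noteq> {}"
  shows "(\<forall>p \<in> chernov_domain U. 
           (\<forall>i j. torsion h (frame h (Ver j)) (frame h (Hor i)) p =
                (\<Sum>k\<in>UNIV. cartan_C h i j k p *\<^sub>R frame h (Hor k) p)
              + (\<Sum>k\<in>UNIV. (- 1 / 2 * varkappa h (fst p) * cartan_C h i j k p) *\<^sub>R frame h (Ver k) p)) \<and>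
           (\<forall>j. torsion h (frame h (Hor j)) (frame h Tm) p =
                (\<Sum>k\<in>UNIV. (1 / 2 * (deriv (varkappa h) (fst p) - varkappa h (fst p) * varkappa h (fst p))
                   * (if j = k then 1 else 0)) *\<^sub>R frame h (Ver k) p)) \<and>
           torsion h (frame h Tm) (frame h Tm) p = 0 \<and>
           (\<forall>i. torsion h (frame h Tm) (frame h (Ver i)) p = 0) \<and>
           (\<forall>i j. torsion h (frame h (Hor i)) (frame h (Hor j)) p = 0) \<and>
           (\<forall>i j. torsion h (frame h (Ver i)) (frame h (Ver j)) p = 0)) \<and>
         effective_torsions U = {(VB, {HB, VB}), (HB, {HB, VB}), (VB, {TB, HB})}"
proof (intro conjI ballI allI)
  fix p assume "p \<in> chernov_domain U"
  then have "chernov_S p \<noteq> 0"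
    by (simp add: chernov_domain_def)
  note T = torsion_frame[OF assms(1) this]
  show "torsion h (frame h (Ver j)) (frame h (Hor i)) p =
           (\<Sum>k\<in>UNIV. cartan_C h i j k p *\<^sub>R frame h (Hor k) p)
         + (\<Sum>k\<in>UNIV. (- 1 / 2 * varkappa h (fst p) * cartan_C h i j k p) *\<^sub>R frame h (Ver k) p)"
    for i j by (rule T)
  show "torsion h (frame h (Hor j)) (frame h Tm) p =
           (\<Sum>k\<in>UNIV. (1 / 2 * (deriv (varkappa h) (fst p) - varkappa h (fst p) * varkappa h (fst p))
             * (if j = k then 1 else 0)) *\<^sub>R frame h (Ver k) p)" for j
    by (rule T)
  show "torsion h (frame h Tm) (frame h Tm) p = 0"
    by (rule T)
  show "torsion h (frame h Tm) (frame h (Ver i)) p = 0" for i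
    by (rule T)
  show "torsion h (frame h (Hor i)) (frame h (Hor j)) p = 0" for i j
    by (rule T)
  show "torsion h (frame h (Ver i)) (frame h (Ver j)) p = 0" for i j
    by (rule T)
qed (rule effective_torsions_eq[OF assms(3)])

end
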